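(* Let $A$ be an $m \times n$ matrix with complex entries. If $A$ is a $(q,k,t)$-design matrix, then $$\operatorname{rank}(A) \;\geq\; \frac{n}{1 + \frac{q(q-1)mt}{nk^2}} \;\geq\; n - \frac{mtq(q-1)}{k^2}.$$
   Context: For a vector $v \in \mathbb{C}^N$, $\operatorname{supp}(v) = \{i : v_i \neq 0\}$. Let $A$ be an $m\times n$ matrix over $\mathbb{C}$ with rows $R_1,\dots,R_m \in \mathbb{C}^n$ and columns $C_1,\dots,C_n \in \mathbb{C}^m$. $A$ is a $(q,k,t)$-design matrix (with $q,k$ positive integers and $t$ a nonnegative integer) if: (1) $|\operatorname{supp}(R_i)| \le q$ for all $i \in [m]$; (2) $|\operatorname{supp}(C_j)| \ge k$ for all $j \in [n]$; (3) $|\operatorname{supp}(C_{j_1}) \cap \operatorname{supp}(C_{j_2})| \le t$ for all $j_1 \ne j_2 \in [n]$. *)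

theory Defs
  imports "HOL-Analysis.Analysis"
begin

definition vec_supp :: "complex ^ 'l \<Rightarrow> 'l set" where
  "vec_supp v = {i. v $ i \<noteq> 0}"

definition design_matrix :: "nat \<Rightarrow> nat \<Rightarrow> nat \<Rightarrow> complex ^ 'n ^ 'm \<Rightarrow> bool" where
  "design_matrix q k t A \<longleftrightarrow>
     q > 0 \<and> k > 0 \<and>
     (\<forall>i. card (vec_supp (row i A)) \<le> q) \<and>
     (\<forall>j. card (vec_supp (column j A)) \<ge> k) \<and>
     (\<forall>j1 j2. j1 \<noteq> j2 \<longrightarrow>
        card (vec_supp (column j1 A) \<inter> vec_supp (column j2 A)) \<le> t)"

end

theory Submission
  imports Defs
begin

text \<open>
  Let \<open>d j\<close> be the size of the support of column \<open>j\<close>. The matrix with entries \<open>1 / d j\<close> on the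
  support of \<open>A\<close> has column sums 1 and row sums \<open>r i\<close> at most \<open>p i / k\<close>, where \<open>p i\<close> is the size
  of the support of row \<open>i\<close>. Since such a matrix exists with exactly the support of \<open>A\<close>, rows and
  columns of \<open>A\<close> can be rescaled so that the squared moduli \<open>P i j\<close> of the new entries have the
  same row and column sums: the scaling is read off a minimiser of a coercive convex function.
  The Gram matrix \<open>G\<close> of the \<open>n\<close> scaled columns has unit diagonal; by Cauchy-Schwarz its
  off-diagonal part has squared Frobenius norm at most
  \<open>t * (\<Sum>i. (r i)\<^sup>2 - (\<Sum>j. (P i j)\<^sup>2)) \<le> n * t * (q - 1) / k\<close>. The rank is at least the squared
  trace of \<open>G\<close> divided by its squared Frobenius norm, that is, at least
  \<open>n / (1 + t * (q - 1) / k)\<close>, and \<open>n * k \<le> q * m\<close> turns this into the claimed bound.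
\<close>

section \<open>Convex minimisation and matrix scaling\<close>

text \<open>For \<open>s \<ge> 0\<close>, bound \<open>w * exp s\<close> below by its tangent line
  of slope \<open>2 * c\<close>, which touches it at \<open>ln (2 * c / w)\<close>; half of that
  slope survives the subtraction. For \<open>s < 0\<close> the linear term alone equals
  \<open>c * \<bar>s\<bar>\<close>.\<close>

lemma exp_minus_linear_coercive:
  fixes w c :: real
  assumes "w > 0" "c > 0"
  shows "\<exists>K. \<forall>s. c * \<bar>s\<bar> - K \<le> w * exp s - c * s"
proof (intro exI allI)
  define L where "L = 2 * c * (ln (2 * c / w) - 1)"
  fix s
  have "2 * c * (1 + (s - ln (2 * c / w))) \<le> 2 * c * exp (s - ln (2 * c / w))"
    using assms by (intro mult_left_mono exp_ge_add_one_self) auto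
  also have "\<dots> = w * exp s"
    using assms by (simp add: exp_diff)
  finally have "2 * c * s - L \<le> w * exp s"
    by (simp add: L_def algebra_simps)
  moreover have "w * exp s > 0" using assms by simp
  ultimately show "c * \<bar>s\<bar> - max 0 L \<le> w * exp s - c * s"
    by (cases "s \<ge> 0") auto
qed

text \<open>The vanishing sum is the derivative in direction \<open>u\<close> of the sum
  \<open>F\<close> of the functions \<open>w e * exp s - c e * s\<close>. Since \<open>F\<close> is
  continuous and coercive, it attains a minimum on the closed set \<open>S\<close>, and there all
  derivatives along \<open>S\<close> vanish.\<close>

lemma exp_minus_linear_critical_point:
  fixes w c :: "'e::finite \<Rightarrow> real" and S :: "(real ^ 'e) set"
  assumes w: "\<And>e. w e > 0" and c: "\<And>e. c e > 0" and S: "subspace S"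
  obtains z where "z \<in> S"
    "\<And>u. u \<in> S \<Longrightarrow> (\<Sum>e\<in>UNIV. (w e * exp (z $ e) - c e) * u $ e) = 0"
proof -
  define F :: "real ^ 'e \<Rightarrow> real" where
    "F z = (\<Sum>e\<in>UNIV. w e * exp (z $ e) - c e * z $ e)" for z
  have "\<forall>e. \<exists>K. \<forall>s. c e * \<bar>s\<bar> - K \<le> w e * exp s - c e * s"
    using exp_minus_linear_coercive[OF w c] by blast
  then obtain K where K: "\<And>e s. c e * \<bar>s\<bar> - K e \<le> w e * exp s - c e * s"
    by metis
  define \<mu> where "\<mu> = Min (range c)"
  have \<mu>: "\<mu> > 0" "\<And>e. \<mu> \<le> c e"
    using c by (auto simp: \<mu>_def)
  have coercive: "\<mu> * norm z - sum K UNIV \<le> F z" for z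
  proof -
    have "\<mu> * norm z \<le> \<mu> * (\<Sum>e\<in>UNIV. \<bar>z $ e\<bar>)"
      using \<mu> norm_le_l1_cart[of z] by (intro mult_left_mono) auto
    also have "\<dots> \<le> (\<Sum>e\<in>UNIV. c e * \<bar>z $ e\<bar>)"
      unfolding sum_distrib_left using \<mu> by (intro sum_mono mult_right_mono) auto
    finally show ?thesis
      using sum_mono[of UNIV "\<lambda>e. c e * \<bar>z $ e\<bar> - K e", OF K]
      by (simp add: F_def sum_subtractf)
  qed
  \<comment> \<open>Coercivity confines the sublevel set of \<open>F 0\<close> to the ball of radius
    \<open>R\<close>, so minimising over the compact part of \<open>S\<close> in that ball
    suffices.\<close>
  define R where "R = (F 0 + sum K UNIV) / \<mu>"
  have inside: "norm z \<le> R" if "F z \<le> F 0" for z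
    using coercive[of z] that \<mu> by (simp add: R_def field_simps)
  have "0 \<in> S \<inter> cball 0 R"
    using inside[of 0] subspace_0[OF S] by simp
  moreover have "compact (S \<inter> cball 0 R)"
    by (intro closed_Int_compact closed_subspace S compact_cball)
  moreover have "continuous_on (S \<inter> cball 0 R) F"
    unfolding F_def by (intro continuous_intros)
  ultimately obtain z where z: "z \<in> S \<inter> cball 0 R" "\<And>y. y \<in> S \<inter> cball 0 R \<Longrightarrow> F z \<le> F y"
    using continuous_attains_inf[of "S \<inter> cball 0 R" F] by blast
  have zmin: "F z \<le> F y" if "y \<in> S" for y
  proof (cases "F y \<le> F 0")
    case True
    then show ?thesis using inside that z(2) by simp
  next
    case False
    then show ?thesis using z(2)[OF \<open>0 \<in> S \<inter> cball 0 R\<close>] by simp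
  qed
  have "(\<Sum>e\<in>UNIV. (w e * exp (z $ e) - c e) * u $ e) = 0" if u: "u \<in> S" for u
  proof -
    define \<phi> where "\<phi> h = F (z + h *\<^sub>R u)" for h
    have "(\<phi> has_real_derivative (\<Sum>e\<in>UNIV. (w e * exp (z $ e) - c e) * u $ e)) (at 0)"
      unfolding \<phi>_def F_def
      by (auto intro!: derivative_eq_intros simp: algebra_simps)
    moreover have "\<phi> 0 \<le> \<phi> h" for h
      using zmin[of "z + h *\<^sub>R u"] z(1) u S by (simp add: \<phi>_def subspace_add subspace_scale)
    ultimately show ?thesis
      using DERIV_local_min[of \<phi> _ 0 1] by simp
  qed
  then show thesis using that z(1) by blast
qed

text \<open>Off \<open>E\<close> the weights are replaced by 1, where the admissible directions vanish.\<close>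
lemma matrix_scaling:
  fixes W c :: "'m::finite \<Rightarrow> 'n::finite \<Rightarrow> real"
  assumes pos: "\<And>i j. (i, j) \<in> E \<Longrightarrow> W i j > 0 \<and> c i j > 0"
    and zero: "\<And>i j. (i, j) \<notin> E \<Longrightarrow> W i j = 0 \<and> c i j = 0"
  obtains x y where
    "\<And>i. (\<Sum>j\<in>UNIV. W i j * exp (x i + y j)) = (\<Sum>j\<in>UNIV. c i j)"
    "\<And>j. (\<Sum>i\<in>UNIV. W i j * exp (x i + y j)) = (\<Sum>i\<in>UNIV. c i j)"
proof -
  define w' where "w' = (\<lambda>(i, j). if (i, j) \<in> E then W i j else 1)"
  define c' where "c' = (\<lambda>(i, j). if (i, j) \<in> E then c i j else 1)"
  \<comment> \<open>The log-scalings of rows and columns, as vectors indexed by matrix positions;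
    they form the subspace on which the convex function is minimised.\<close>
  define Z :: "('m \<Rightarrow> real) \<Rightarrow> ('n \<Rightarrow> real) \<Rightarrow> real ^ ('m \<times> 'n)" where
    "Z x y = (\<chi> e. if e \<in> E then x (fst e) + y (snd e) else 0)" for x y
  define S where "S = {z. \<exists>x y. z = Z x y}"
  have "subspace S"
  proof (rule subspaceI)
    have "0 = Z (\<lambda>_. 0) (\<lambda>_. 0)" by (simp add: Z_def vec_eq_iff)
    then show "0 \<in> S" unfolding S_def by blast
  next
    fix u v assume "u \<in> S" "v \<in> S"
    then obtain x y x' y' where "u = Z x y" "v = Z x' y'" by (auto simp: S_def)
    then have "u + v = Z (\<lambda>i. x i + x' i) (\<lambda>j. y j + y' j)"
      by (simp add: Z_def vec_eq_iff)
    then show "u + v \<in> S" unfolding S_def by blast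
  next
    fix r u assume "u \<in> S"
    then obtain x y where "u = Z x y" by (auto simp: S_def)
    then have "r *\<^sub>R u = Z (\<lambda>i. r * x i) (\<lambda>j. r * y j)"
      by (simp add: Z_def vec_eq_iff distrib_left)
    then show "r *\<^sub>R u \<in> S" unfolding S_def by blast
  qed
  moreover have "w' e > 0" "c' e > 0" for e
    using pos by (auto simp: w'_def c'_def split: prod.split)
  ultimately obtain z where "z \<in> S"
    and crit: "\<And>u. u \<in> S \<Longrightarrow> (\<Sum>e\<in>UNIV. (w' e * exp (z $ e) - c' e) * u $ e) = 0"
    using exp_minus_linear_critical_point[of w' c' S] by metis
  then obtain x y where z: "z = Z x y" by (auto simp: S_def)
  have crit': "(\<Sum>i\<in>UNIV. \<Sum>j\<in>UNIV. (W i j * exp (x i + y j) - c i j) * (a i + b j)) = 0" for a b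
  proof -
    have "0 = (\<Sum>e\<in>UNIV. (w' e * exp (z $ e) - c' e) * Z a b $ e)"
      using crit[of "Z a b"] by (auto simp: S_def)
    also have "\<dots> = (\<Sum>(i, j)\<in>UNIV \<times> UNIV. (W i j * exp (x i + y j) - c i j) * (a i + b j))"
      using zero by (intro sum.cong) (auto simp: z Z_def w'_def c'_def)
    finally show ?thesis by (simp add: sum.cartesian_product)
  qed
  show thesis
  proof (rule that[of x y])
    fix i
    \<comment> \<open>Varying only the exponent of row \<open>i\<close> isolates the equation for
      its row sum; columns are treated alike.\<close>
    have "(\<Sum>k\<in>UNIV. if k = i then \<Sum>j\<in>UNIV. W k j * exp (x k + y j) - c k j else 0) = 0"
      using crit'[of "\<lambda>k. if k = i then 1 else 0" "\<lambda>_. 0"]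
      by (simp add: if_distrib if_distribR sum.If_cases cong: if_cong sum.cong)
    then show "(\<Sum>j\<in>UNIV. W i j * exp (x i + y j)) = (\<Sum>j\<in>UNIV. c i j)"
      by (simp add: sum_subtractf)
  next
    fix j
    have "(\<Sum>i\<in>UNIV. W i j * exp (x i + y j) - c i j) = 0"
      using crit'[of "\<lambda>_. 0" "\<lambda>k. if k = j then 1 else 0"] by (simp add: if_distrib cong: if_cong)
    then show "(\<Sum>i\<in>UNIV. W i j * exp (x i + y j)) = (\<Sum>i\<in>UNIV. c i j)"
      by (simp add: sum_subtractf)
  qed
qed

section \<open>Rank against trace and Frobenius norm of a Gram matrix\<close>

text \<open>In an orthonormal basis of \<open>S\<close>, the Gram matrix has the same trace and
  Frobenius norm as the matrix \<open>T\<close> of size \<open>dim S\<close> representing the sum of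
  the outer products of the \<open>v a\<close> with themselves. Cauchy-Schwarz on the diagonal of
  \<open>T\<close> then gives the bound.\<close>

lemma gram_trace_bound:
  fixes v :: "'a \<Rightarrow> 'b::euclidean_space"
  assumes S: "subspace S" and v: "\<And>a. a \<in> I \<Longrightarrow> v a \<in> S"
  shows "(\<Sum>a\<in>I. v a \<bullet> v a)\<^sup>2 \<le> real (dim S) * (\<Sum>a\<in>I. \<Sum>b\<in>I. (v a \<bullet> v b)\<^sup>2)"
proof -
  obtain B where B: "B \<subseteq> S" "pairwise orthogonal B" "\<And>x. x \<in> B \<Longrightarrow> norm x = 1"
    "independent B" "card B = dim S" "span B = S"
    using orthonormal_basis_subspace[OF S] by metis
  have fin: "finite B" using B(4) by (rule independent_imp_finite)
  have expand: "v a \<bullet> v b = (\<Sum>s\<in>B. (v a \<bullet> s) * (v b \<bullet> s))" if "a \<in> I" "b \<in> I" for a b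
  proof -
    have "v a = (\<Sum>s\<in>B. (s \<bullet> v a) *\<^sub>R s)"
      using orthonormal_basis_expand[of B "v a"] B fin v that by (auto simp: inner_commute)
    then have "v a \<bullet> v b = (\<Sum>s\<in>B. (s \<bullet> v a) *\<^sub>R s) \<bullet> v b" by simp
    then show ?thesis
      unfolding inner_sum_left inner_scaleR_left by (simp add: inner_commute)
  qed
  define T where "T s t = (\<Sum>a\<in>I. (v a \<bullet> s) * (v a \<bullet> t))" for s t
  have "(\<Sum>a\<in>I. v a \<bullet> v a) = (\<Sum>s\<in>B. T s s)"
    unfolding T_def by (subst sum.swap) (simp add: expand)
  then have "(\<Sum>a\<in>I. v a \<bullet> v a)\<^sup>2 \<le> (\<Sum>s\<in>B. (T s s)\<^sup>2) * real (card B)"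
    using sum_squared_le_sum_of_squares[of "\<lambda>s. T s s" B] by simp
  also have "\<dots> \<le> (\<Sum>s\<in>B. \<Sum>t\<in>B. (T s t)\<^sup>2) * real (card B)"
    using fin by (intro mult_right_mono sum_mono member_le_sum) auto
  \<comment> \<open>Both squared Frobenius norms are the same fourfold sum, taken in different
    orders.\<close>
  also have "(\<Sum>s\<in>B. \<Sum>t\<in>B. (T s t)\<^sup>2) =
      (\<Sum>s\<in>B. \<Sum>t\<in>B. \<Sum>a\<in>I. \<Sum>b\<in>I. (v a \<bullet> s) * (v b \<bullet> s) * ((v a \<bullet> t) * (v b \<bullet> t)))"
    unfolding T_def power2_eq_square sum_product by (intro sum.cong refl) simp
  also have "\<dots> = (\<Sum>a\<in>I. \<Sum>s\<in>B. \<Sum>t\<in>B. \<Sum>b\<in>I. (v a \<bullet> s) * (v b \<bullet> s) * ((v a \<bullet> t) * (v b \<bullet> t)))"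
    by (simp only: sum.swap[of _ I B])
  also have "\<dots> = (\<Sum>a\<in>I. \<Sum>b\<in>I. \<Sum>s\<in>B. \<Sum>t\<in>B. (v a \<bullet> s) * (v b \<bullet> s) * ((v a \<bullet> t) * (v b \<bullet> t)))"
    by (simp only: sum.swap[of _ I B])
  also have "\<dots> = (\<Sum>a\<in>I. \<Sum>b\<in>I. (v a \<bullet> v b)\<^sup>2)"
    by (intro sum.cong refl) (simp add: expand power2_eq_square sum_product)
  finally show ?thesis by (simp add: B(5) mult.commute)
qed


text \<open>The real bound applied to the columns of the scaled matrix together with their multiples
  by \<open>\<i>\<close>: this doubles both the trace and the dimension.\<close>
lemma rank_gram_bound:
  fixes A :: "complex ^ 'n ^ 'm" and D :: "'m \<Rightarrow> complex" and E :: "'n \<Rightarrow> complex"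
  defines "X \<equiv> \<lambda>i j. D i * A $ i $ j * E j"
  shows "(\<Sum>j\<in>UNIV. \<Sum>i\<in>UNIV. (cmod (X i j))\<^sup>2)\<^sup>2 \<le>
    real (rank A) * (\<Sum>j\<in>UNIV. \<Sum>l\<in>UNIV. (cmod (\<Sum>i\<in>UNIV. X i j * cnj (X i l)))\<^sup>2)"
proof -
  obtain B where B: "vec.independent B" "rows A \<subseteq> vec.span B" "card B = rank A"
    using vec.basis_exists[of "rows A"] unfolding row_rank_def_gen by metis
  have fin: "finite B" using B(1) by (rule vec.finiteI_independent)
  have "\<exists>u. A $ i = (\<Sum>b\<in>B. u b *s b)" for i
  proof -
    have "A $ i \<in> vec.span B" using B(2) by (auto simp: rows_def row_def)
    then show ?thesis by (auto simp: vec.span_finite[OF fin])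
  qed
  then obtain u where u: "\<And>i. A $ i = (\<Sum>b\<in>B. u i b *s b)" by metis
  \<comment> \<open>The coefficients of the rows over the basis \<open>B\<close> factor
    \<open>A\<close> through dimension \<open>rank A\<close>. Read by columns, every column of
    \<open>X\<close> is a complex combination of the vectors \<open>U 1 b\<close>; real combinations
    need the \<open>U \<i> b\<close> as well.\<close>
  define U :: "complex \<Rightarrow> complex ^ 'n \<Rightarrow> complex ^ 'm" where
    "U z b = (\<chi> i. z * (D i * u i b))" for z b
  define S where "S = span (U 1 ` B \<union> U \<i> ` B)"
  have U: "U z b \<in> S" if "b \<in> B" for z b
  proof -
    have "U z b = Re z *\<^sub>R U 1 b + Im z *\<^sub>R U \<i> b"
      by (simp add: U_def vec_eq_iff complex_eq_iff algebra_simps)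
    then show ?thesis
      using that by (auto simp: S_def intro!: span_add span_scale intro: span_base)
  qed
  have "dim S \<le> card (U 1 ` B \<union> U \<i> ` B)"
    unfolding S_def dim_span using fin by (intro dim_le_card') auto
  also have "\<dots> \<le> card (U 1 ` B) + card (U \<i> ` B)" by (rule card_Un_le)
  also have "\<dots> \<le> 2 * rank A"
    using card_image_le[OF fin, of "U 1"] card_image_le[OF fin, of "U \<i>"] B(3) by linarith
  finally have dim: "real (dim S) \<le> 2 * real (rank A)" by linarith
  define v :: "'n \<times> bool \<Rightarrow> complex ^ 'm" where
    "v = (\<lambda>(j, b). \<chi> i. (if b then \<i> else 1) * X i j)"
  have "v (j, b) = (\<Sum>e\<in>B. U ((if b then \<i> else 1) * E j * e $ j) e)" for j b
    by (simp add: v_def U_def vec_eq_iff X_def u sum_distrib_left sum_distrib_right mult_ac)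
  then have vS: "v a \<in> S" for a
    using U by (cases a) (auto simp: S_def intro!: span_sum)
  define g where "g j l = (\<Sum>i\<in>UNIV. X i j * cnj (X i l))" for j l
  \<comment> \<open>The four real inner products are, up to sign, the real and imaginary part of
    \<open>g j l\<close>, each occurring twice.\<close>
  have gram: "(\<Sum>b\<in>UNIV. \<Sum>b'\<in>UNIV. (v (j, b) \<bullet> v (l, b'))\<^sup>2) = 2 * (cmod (g j l))\<^sup>2" for j l
  proof -
    have "v (j, False) \<bullet> v (l, False) = Re (g j l)" "v (j, True) \<bullet> v (l, True) = Re (g j l)"
      "v (j, True) \<bullet> v (l, False) = - Im (g j l)" "v (j, False) \<bullet> v (l, True) = Im (g j l)"
      by (simp_all add: v_def g_def inner_vec_def inner_complex_def sum_negf[symmetric]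
          algebra_simps)
    then show ?thesis by (simp add: UNIV_bool cmod_power2)
  qed
  have diag: "v (j, b) \<bullet> v (j, b) = (\<Sum>i\<in>UNIV. (cmod (X i j))\<^sup>2)" for j b
    by (simp add: v_def inner_vec_def norm_mult flip: power2_norm_eq_inner)
  have pair_sum: "(\<Sum>a\<in>UNIV. f a) = (\<Sum>j\<in>UNIV. \<Sum>b\<in>UNIV. f (j, b))"
    for f :: "'n \<times> bool \<Rightarrow> real"
    by (simp add: sum.cartesian_product)
  have "(\<Sum>a\<in>UNIV. v a \<bullet> v a) = (\<Sum>j\<in>UNIV. \<Sum>b\<in>UNIV. v (j, b) \<bullet> v (j, b))"
    by (rule pair_sum)
  also have "\<dots> = 2 * (\<Sum>j\<in>UNIV. \<Sum>i\<in>UNIV. (cmod (X i j))\<^sup>2)"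
    by (simp add: diag sum_distrib_left)
  finally have trace: "(\<Sum>a\<in>UNIV. v a \<bullet> v a) = \<dots>" .
  have "(\<Sum>a\<in>UNIV. \<Sum>b\<in>UNIV. (v a \<bullet> v b)\<^sup>2) =
      (\<Sum>j\<in>UNIV. \<Sum>b\<in>UNIV. \<Sum>l\<in>UNIV. \<Sum>b'\<in>UNIV. (v (j, b) \<bullet> v (l, b'))\<^sup>2)"
    by (simp only: pair_sum)
  also have "\<dots> = (\<Sum>j\<in>UNIV. \<Sum>l\<in>UNIV. 2 * (cmod (g j l))\<^sup>2)"
    by (subst sum.swap[of _ UNIV "UNIV :: bool set"]) (simp only: gram)
  finally have frob: "(\<Sum>a\<in>UNIV. \<Sum>b\<in>UNIV. (v a \<bullet> v b)\<^sup>2) = 2 * (\<Sum>j\<in>UNIV. \<Sum>l\<in>UNIV. (cmod (g j l))\<^sup>2)"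
    by (simp add: sum_distrib_left)
  let ?T = "\<Sum>j\<in>UNIV. \<Sum>i\<in>UNIV. (cmod (X i j))\<^sup>2"
  let ?G = "\<Sum>j\<in>UNIV. \<Sum>l\<in>UNIV. (cmod (g j l))\<^sup>2"
  have "(2 * ?T)\<^sup>2 \<le> real (dim S) * (2 * ?G)"
    using gram_trace_bound[of S UNIV v] vS unfolding trace frob by (simp add: S_def)
  also have "\<dots> \<le> 2 * real (rank A) * (2 * ?G)"
    using dim by (intro mult_right_mono) (auto intro!: sum_nonneg)
  finally show ?thesis by (simp add: g_def power_mult_distrib)
qed

section \<open>The rank of a design matrix\<close>

lemma design_matrix_rank_bound:
  fixes A :: "complex ^ 'n ^ 'm"
  assumes "design_matrix q k t A"
  shows "real CARD('n) \<le> real (rank A) * (1 + real t * (real q - 1) / real k)"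
    and "real CARD('n) * real k \<le> real q * real CARD('m)"
proof -
  define d where "d j = card {i. A $ i $ j \<noteq> 0}" for j
  define p where "p i = card {j. A $ i $ j \<noteq> 0}" for i
  have q: "q > 0" and k: "k > 0" and p_le: "\<And>i. p i \<le> q" and d_ge: "\<And>j. k \<le> d j"
    and t: "\<And>j l. j \<noteq> l \<Longrightarrow> card {i. A $ i $ j \<noteq> 0 \<and> A $ i $ l \<noteq> 0} \<le> t"
    using assms
    by (auto simp: design_matrix_def vec_supp_def row_def column_def p_def d_def Int_def)
  have d_pos: "d j > 0" for j using d_ge[of j] k by linarith
  define c where "c i j = (if A $ i $ j \<noteq> 0 then 1 / real (d j) else 0)" for i j
  have c_col: "(\<Sum>i\<in>UNIV. c i j) = 1" for j
    using d_pos[of j] by (auto simp: c_def d_def sum.If_cases card_gt_0_iff)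
  obtain x y where xy:
    "\<And>i. (\<Sum>j\<in>UNIV. (cmod (A $ i $ j))\<^sup>2 * exp (x i + y j)) = (\<Sum>j\<in>UNIV. c i j)"
    "\<And>j. (\<Sum>i\<in>UNIV. (cmod (A $ i $ j))\<^sup>2 * exp (x i + y j)) = (\<Sum>i\<in>UNIV. c i j)"
    using matrix_scaling[of "{(i, j). A $ i $ j \<noteq> 0}" "\<lambda>i j. (cmod (A $ i $ j))\<^sup>2" c] d_pos
    by (auto simp: c_def)
  \<comment> \<open>The exponents are halved because the scaling was found for squared
    moduli.\<close>
  define X where "X i j = of_real (exp (x i / 2)) * A $ i $ j * of_real (exp (y j / 2))" for i j
  define P where "P i j = (cmod (X i j))\<^sup>2" for i j
  define r where "r i = (\<Sum>j\<in>UNIV. P i j)" for i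
  have P_eq: "P i j = (cmod (A $ i $ j))\<^sup>2 * exp (x i + y j)" for i j
    by (simp add: P_def X_def norm_mult power_mult_distrib exp_add flip: exp_double)
  have P_nonneg: "P i j \<ge> 0" for i j by (simp add: P_def)
  have P_zero: "P i j = 0 \<longleftrightarrow> A $ i $ j = 0" for i j by (simp add: P_eq)
  have P_col: "(\<Sum>i\<in>UNIV. P i j) = 1" for j using xy(2)[of j] c_col by (simp add: P_eq)
  have r_nonneg: "r i \<ge> 0" for i by (simp add: r_def P_nonneg sum_nonneg)
  have r_le: "r i \<le> real (p i) / real k" for i
  proof -
    have "r i = (\<Sum>j\<in>UNIV. c i j)" by (simp add: r_def P_eq xy)
    also have "\<dots> \<le> (\<Sum>j\<in>UNIV. if A $ i $ j \<noteq> 0 then 1 / real k else 0)"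
      using k d_ge d_pos by (intro sum_mono) (auto simp: c_def intro!: divide_left_mono)
    finally show ?thesis by (simp add: p_def sum.If_cases)
  qed
  have r_sum: "(\<Sum>i\<in>UNIV. r i) = real CARD('n)"
    unfolding r_def by (subst sum.swap) (simp add: P_col)
  have "r i \<le> real q / real k" for i
    by (rule order_trans[OF r_le]) (simp add: divide_right_mono p_le)
  then have "(\<Sum>i\<in>UNIV. r i) \<le> (\<Sum>i\<in>(UNIV :: 'm set). real q / real k)"
    by (intro sum_mono)
  then show "real CARD('n) * real k \<le> real q * real CARD('m)"
    using k by (simp add: r_sum field_simps)
  \<comment> \<open>Cauchy-Schwarz on the support of row \<open>i\<close> bounds the left side by
    \<open>r i * (r i / p i) * (p i - 1)\<close>; then \<open>r i / p i \<le> 1 / k\<close> and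
    \<open>p i \<le> q\<close> finish. An empty row is split off to permit the division.\<close>
  have row: "r i * r i - (\<Sum>j\<in>UNIV. (P i j)\<^sup>2) \<le> r i * ((real q - 1) / real k)" for i
  proof (cases "p i = 0")
    case True
    then have "r i = 0" using r_le[of i] r_nonneg[of i] by simp
    then show ?thesis by (simp add: sum_nonneg)
  next
    case False
    have "r i = (\<Sum>j | A $ i $ j \<noteq> 0. P i j)"
      unfolding r_def by (rule sum.mono_neutral_right) (auto simp: P_zero)
    then have "(r i)\<^sup>2 \<le> (\<Sum>j | A $ i $ j \<noteq> 0. (P i j)\<^sup>2) * real (p i)"
      using sum_squared_le_sum_of_squares[of "P i" "{j. A $ i $ j \<noteq> 0}"] by (simp add: p_def)
    also have "(\<Sum>j | A $ i $ j \<noteq> 0. (P i j)\<^sup>2) = (\<Sum>j\<in>UNIV. (P i j)\<^sup>2)"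
      by (rule sum.mono_neutral_left) (auto simp: P_zero)
    finally have "(r i)\<^sup>2 / real (p i) \<le> (\<Sum>j\<in>UNIV. (P i j)\<^sup>2)"
      using False by (simp add: field_simps)
    then have "r i * r i - (\<Sum>j\<in>UNIV. (P i j)\<^sup>2) \<le> r i * (r i / real (p i) * (real (p i) - 1))"
      using False by (simp add: field_simps power2_eq_square)
    also have "r i / real (p i) * (real (p i) - 1) \<le> 1 / real k * (real q - 1)"
      using r_le[of i] False k p_le[of i] by (intro mult_mono) (auto simp: field_simps)
    finally show ?thesis using r_nonneg[of i] by (simp add: mult_left_mono)
  qed
  define g where "g j l = (cmod (\<Sum>i\<in>UNIV. X i j * cnj (X i l)))\<^sup>2" for j l
  have g_diag: "g j j = 1" for j
  proof -
    have "(\<Sum>i\<in>UNIV. X i j * cnj (X i j)) = of_real (\<Sum>i\<in>UNIV. P i j)"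
      by (simp add: P_def flip: complex_norm_square)
    then show ?thesis by (simp add: g_def P_col)
  qed
  \<comment> \<open>Only the at most \<open>t\<close> rows in the common support contribute, so
    Cauchy-Schwarz costs a factor \<open>t\<close>.\<close>
  have g_off: "g j l \<le> real t * (\<Sum>i\<in>UNIV. P i j * P i l)" if "j \<noteq> l" for j l
  proof -
    let ?I = "{i. A $ i $ j \<noteq> 0 \<and> A $ i $ l \<noteq> 0}"
    have "(\<Sum>i\<in>UNIV. X i j * cnj (X i l)) = (\<Sum>i\<in>?I. X i j * cnj (X i l))"
      by (rule sum.mono_neutral_right) (auto simp: X_def)
    also have "cmod \<dots> \<le> (\<Sum>i\<in>?I. cmod (X i j) * cmod (X i l))"
      by (rule order_trans[OF norm_sum]) (simp add: norm_mult)
    finally have "g j l \<le> (\<Sum>i\<in>?I. cmod (X i j) * cmod (X i l))\<^sup>2"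
      unfolding g_def by (intro power_mono) auto
    also have "\<dots> \<le> (\<Sum>i\<in>?I. (cmod (X i j) * cmod (X i l))\<^sup>2) * real (card ?I)"
      by (rule sum_squared_le_sum_of_squares)
    also have "\<dots> \<le> (\<Sum>i\<in>UNIV. P i j * P i l) * real t"
      unfolding P_def power_mult_distrib using t[OF that]
      by (intro mult_mono sum_mono2) (auto intro: sum_nonneg)
    finally show ?thesis by (simp add: mult.commute)
  qed
  define n where "n = real CARD('n)"
  define s where "s = real t * (real q - 1) / real k"
  have "(\<Sum>j\<in>UNIV. \<Sum>l\<in>UNIV. g j l) \<le>
      (\<Sum>j\<in>UNIV. 1 + (\<Sum>l\<in>UNIV - {j}. real t * (\<Sum>i\<in>UNIV. P i j * P i l)))"
  proof (rule sum_mono)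
    fix j
    have "(\<Sum>l\<in>UNIV. g j l) = g j j + (\<Sum>l\<in>UNIV - {j}. g j l)"
      by (rule sum.remove) auto
    also have "\<dots> \<le> 1 + (\<Sum>l\<in>UNIV - {j}. real t * (\<Sum>i\<in>UNIV. P i j * P i l))"
      unfolding g_diag by (intro add_left_mono sum_mono g_off) auto
    finally show "(\<Sum>l\<in>UNIV. g j l) \<le> \<dots>" .
  qed
  also have "\<dots> = n + real t * (\<Sum>j\<in>UNIV. \<Sum>i\<in>UNIV. P i j * (r i - P i j))"
  proof -
    have "(\<Sum>l\<in>UNIV - {j}. \<Sum>i\<in>UNIV. P i j * P i l) = (\<Sum>i\<in>UNIV. P i j * (r i - P i j))" for j
      by (subst sum.swap) (simp add: r_def sum_diff1 flip: sum_distrib_left)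
    then show ?thesis by (simp add: n_def sum.distrib flip: sum_distrib_left)
  qed
  also have "(\<Sum>j\<in>UNIV. \<Sum>i\<in>UNIV. P i j * (r i - P i j)) =
      (\<Sum>i\<in>UNIV. r i * r i - (\<Sum>j\<in>UNIV. (P i j)\<^sup>2))"
    by (subst sum.swap)
       (simp add: right_diff_distrib sum_subtractf r_def sum_distrib_right power2_eq_square)
  also have "\<dots> \<le> (\<Sum>i\<in>UNIV. r i * ((real q - 1) / real k))"
    by (intro sum_mono row)
  also have "\<dots> = n * ((real q - 1) / real k)"
    by (simp only: n_def flip: r_sum sum_distrib_right)
  finally have "(\<Sum>j\<in>UNIV. \<Sum>l\<in>UNIV. g j l) \<le> n + real t * (n * ((real q - 1) / real k))"
    by (simp add: mult_left_mono)
  then have G: "(\<Sum>j\<in>UNIV. \<Sum>l\<in>UNIV. g j l) \<le> n * (1 + s)"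
    by (simp add: s_def algebra_simps)
  have "n\<^sup>2 = (\<Sum>j\<in>UNIV. \<Sum>i\<in>UNIV. P i j)\<^sup>2"
    by (simp add: P_col n_def)
  also have "\<dots> \<le> real (rank A) * (\<Sum>j\<in>UNIV. \<Sum>l\<in>UNIV. g j l)"
    unfolding P_def g_def X_def by (rule rank_gram_bound)
  also have "\<dots> \<le> real (rank A) * (n * (1 + s))"
    using G by (intro mult_left_mono) auto
  finally have "n * n \<le> n * (real (rank A) * (1 + s))"
    by (simp add: power2_eq_square algebra_simps)
  then show "real CARD('n) \<le> real (rank A) * (1 + real t * (real q - 1) / real k)"
    by (simp add: n_def s_def)
qed

theorem theorem1p3:
  fixes A :: "complex ^ 'n ^ 'm" and q k t :: nat
  assumes "design_matrix q k t A"
  defines "m \<equiv> real CARD('m)" and "n \<equiv> real CARD('n)"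
  shows "real (rank A) \<ge> n / (1 + real q * (real q - 1) * m * real t / (n * (real k)\<^sup>2))
       \<and> n / (1 + real q * (real q - 1) * m * real t / (n * (real k)\<^sup>2))
           \<ge> n - m * real t * real q * (real q - 1) / (real k)\<^sup>2"
proof -
  define s where "s = real q * (real q - 1) * m * real t / (n * (real k)\<^sup>2)"
  have q: "real q \<ge> 1" and k: "real k > 0"
    using assms(1) by (auto simp: design_matrix_def)
  have n: "n > 0" and m: "m > 0" by (auto simp: n_def m_def)
  have s_nonneg: "s \<ge> 0" using q m n by (simp add: s_def)
  \<comment> \<open>The last factor is at least 1, by the double count
    \<open>n * k \<le> q * m\<close> of the support; this brings in \<open>m\<close> and the second
    power of \<open>k\<close>.\<close>
  have "real t * (real q - 1) / real k * 1 \<le> real t * (real q - 1) / real k * (real q * m / (n * real k))"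
    using q k n design_matrix_rank_bound(2)[OF assms(1)]
    by (intro mult_left_mono) (auto simp: n_def m_def)
  also have "\<dots> = s" by (simp add: s_def power2_eq_square mult_ac)
  finally have "real t * (real q - 1) / real k \<le> s" by simp
  then have "real (rank A) * (1 + real t * (real q - 1) / real k) \<le> real (rank A) * (1 + s)"
    by (intro mult_left_mono) auto
  then have "n \<le> real (rank A) * (1 + s)"
    using design_matrix_rank_bound(1)[OF assms(1)] by (simp add: n_def)
  then have "n / (1 + s) \<le> real (rank A)"
    using s_nonneg by (simp add: divide_le_eq)
  \<comment> \<open>This is \<open>(1 - s) * (1 + s) \<le> 1\<close>, scaled by
    \<open>n\<close>.\<close>
  moreover have "n - n * s \<le> n / (1 + s)"
    using n s_nonneg by (simp add: le_divide_eq algebra_simps)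
  moreover have "n * s = m * real t * real q * (real q - 1) / (real k)\<^sup>2"
    using n by (simp add: s_def)
  ultimately show ?thesis by (simp add: s_def)
qed

end
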